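(* Let $\varepsilon>0$ be a constant. On every finite simple undirected graph with $n$ vertices and $m$ edges, ADG performs $O(n+m)$ work in the CRCW setting.
   Context: Graphs are stored in adjacency-array (CSR) form. Cost model: a parallel computation is a directed acyclic graph (DAG) of constant-time operations; its work is the number of nodes and its depth is the length of the longest directed path. In the CRCW setting concurrent reads, concurrent writes and atomic read-modify-write operations (e.g. atomic decrement-and-fetch) to the same memory cell take $O(1)$ time. Hidden constants may depend on $\varepsilon$. For $U\subseteq V$, $N_U(v)$ denotes the set of neighbors of $v$ in $U$. Algorithm ADG (parameter $\varepsilon$, input $G=(V,E)$). Initialize $U=V$, $D[v]=\deg(v)$ for all $v$, $\ell=1$. While $U\neq\emptyset$: compute $|U|$ and $\sum_{v\in U}D[v]$ by parallel reductions, and $\widehat\delta=\frac1{|U|}\sum_{v\in U}D[v]$; set $R=\{u\in U: D[u]\le(1+\varepsilon)\widehat\delta\}$; for all $v\in R$ and all $u\in N_U(v)$ in parallel, atomically decrement $D[u]$; set $U=U\setminus R$; set $\rho_{\mathrm{ADG}}(v)=\ell$ for all $v\in R$ in parallel; set $\ell=\ell+1$. Implementation assumptions: membership in $U$ and $R$ is tested in $O(1)$; in each iteration the reductions over $U$ and the construction of $R$ take $O(|U|)$ work, and the removal $U\setminus R$ takes $O(|R|)$ work; the degree update takes work proportional to $\sum_{v\in R}\deg(v)$. *)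

theory Defs
  imports Complex_Main "HOL-Library.Extended_Nat"
begin

definition simple_graph :: "'v set \<Rightarrow> 'v set set \<Rightarrow> bool" where
  "simple_graph V E \<longleftrightarrow> finite V \<and> (\<forall>e\<in>E. e \<subseteq> V \<and> card e = 2)"

definition nbrs :: "'v set set \<Rightarrow> 'v set \<Rightarrow> 'v \<Rightarrow> 'v set" where
  "nbrs E W v = {u\<in>W. {u, v} \<in> E}"

definition deg :: "'v set \<Rightarrow> 'v set set \<Rightarrow> 'v \<Rightarrow> nat" where
  "deg V E v = card (nbrs E V v)"

record 'v adg_state =
  st_U :: "'v set"
  st_D :: "'v \<Rightarrow> int"
  st_rho :: "'v \<rightharpoonup> nat"
  st_level :: nat

definition adg_init :: "'v set \<Rightarrow> 'v set set \<Rightarrow> 'v adg_state" where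
  "adg_init V E =
     \<lparr>st_U = V, st_D = (\<lambda>v. int (deg V E v)), st_rho = Map.empty, st_level = 1\<rparr>"

definition adg_avg :: "'v adg_state \<Rightarrow> real" where
  "adg_avg s = 1 / real (card (st_U s)) * (\<Sum>v\<in>st_U s. real_of_int (st_D s v))"

definition adg_R :: "real \<Rightarrow> 'v adg_state \<Rightarrow> 'v set" where
  "adg_R \<epsilon> s = {u \<in> st_U s. real_of_int (st_D s u) \<le> (1 + \<epsilon>) * adg_avg s}"

text \<open>The effect of one loop iteration. Atomic decrements do not lose updates, so
  the parallel degree update subtracts from the entry of u the number of pairs (v, u) with v in R
  and u a neighbour of v in U. Here U is the set before the removal of R.\<close>

definition adg_body :: "'v set set \<Rightarrow> real \<Rightarrow> 'v adg_state \<Rightarrow> 'v adg_state" where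
  "adg_body E \<epsilon> s = (let R = adg_R \<epsilon> s in
     \<lparr>st_U = st_U s - R,
      st_D = (\<lambda>u. st_D s u - int (card {v\<in>R. u \<in> nbrs E (st_U s) v})),
      st_rho = (\<lambda>v. if v \<in> R then Some (st_level s) else st_rho s v),
      st_level = st_level s + 1\<rparr>)"

text \<open>The state after i iterations of the loop body, counted from 0. It is the state at the i-th
  evaluation of the loop test only if all earlier tests succeeded, which is what the predicate
  \<open>executed\<close> below keeps track of.\<close>

definition adg_state_at :: "'v set \<Rightarrow> 'v set set \<Rightarrow> real \<Rightarrow> nat \<Rightarrow> 'v adg_state" where
  "adg_state_at V E \<epsilon> i = (adg_body E \<epsilon> ^^ i) (adg_init V E)"

abbreviation adg_U_at :: "'v set \<Rightarrow> 'v set set \<Rightarrow> real \<Rightarrow> nat \<Rightarrow> 'v set" where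
  "adg_U_at V E \<epsilon> i \<equiv> st_U (adg_state_at V E \<epsilon> i)"

abbreviation adg_R_at :: "'v set \<Rightarrow> 'v set set \<Rightarrow> real \<Rightarrow> nat \<Rightarrow> 'v set" where
  "adg_R_at V E \<epsilon> i \<equiv> adg_R \<epsilon> (adg_state_at V E \<epsilon> i)"

text \<open>A parallel computation: nodes are constant-time operations, edges are dependencies. Work
  is the number of nodes. It is infinite for a computation that does not stop.\<close>

record 'b comp_dag =
  ops :: "'b set"
  deps :: "('b \<times> 'b) set"

definition is_dag :: "'b comp_dag \<Rightarrow> bool" where
  "is_dag K \<longleftrightarrow> deps K \<subseteq> ops K \<times> ops K \<and> acyclic (deps K)"

definition work :: "'b comp_dag \<Rightarrow> enat" where
  "work K = (if finite (ops K) then enat (card (ops K)) else \<infinity>)"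

text \<open>The program steps; the argument is the number of the iteration.\<close>

datatype adg_step =
    Init             \<comment> \<open>initialize U, D and the level counter\<close>
  | Guard nat        \<comment> \<open>test whether U is empty\<close>
  | Reduce nat       \<comment> \<open>size of U, sum of D over U, and their quotient\<close>
  | Select nat       \<comment> \<open>construct R\<close>
  | Update nat       \<comment> \<open>decrement D for the neighbours of R in U\<close>
  | Remove nat       \<comment> \<open>remove R from U\<close>
  | Assign nat       \<comment> \<open>set rho on R\<close>
  | Advance nat      \<comment> \<open>increment the level counter\<close>

context
  fixes V :: "'v set" and E :: "'v set set" and \<epsilon> :: real
begin

definition iterates :: "nat \<Rightarrow> bool" where
  "iterates i \<longleftrightarrow> (\<forall>j\<le>i. adg_U_at V E \<epsilon> j \<noteq> {})"

fun executed :: "adg_step \<Rightarrow> bool" where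
  "executed Init \<longleftrightarrow> True"
| "executed (Guard i) \<longleftrightarrow> (\<forall>j<i. adg_U_at V E \<epsilon> j \<noteq> {})"
| "executed (Reduce i) \<longleftrightarrow> iterates i"
| "executed (Select i) \<longleftrightarrow> iterates i"
| "executed (Update i) \<longleftrightarrow> iterates i"
| "executed (Remove i) \<longleftrightarrow> iterates i"
| "executed (Assign i) \<longleftrightarrow> iterates i"
| "executed (Advance i) \<longleftrightarrow> iterates i"

text \<open>The order of the work of each step. With adjacency arrays a degree is the difference of
  two offsets, so initialization is linear in the number of vertices. The update scans the whole
  adjacency lists of the vertices in R; as concurrent atomic decrements of one cell take constant
  time each and membership tests are constant-time, its work is of the order of the sum of their
  degrees in the input graph.\<close>

fun step_size :: "adg_step \<Rightarrow> nat" where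
  "step_size Init = 1 + card V"
| "step_size (Guard i) = 1"
| "step_size (Reduce i) = card (adg_U_at V E \<epsilon> i)"
| "step_size (Select i) = card (adg_U_at V E \<epsilon> i)"
| "step_size (Update i) = (\<Sum>v\<in>adg_R_at V E \<epsilon> i. deg V E v)"
| "step_size (Remove i) = card (adg_R_at V E \<epsilon> i)"
| "step_size (Assign i) = card (adg_R_at V E \<epsilon> i)"
| "step_size (Advance i) = 1"

text \<open>K is the computation of a run of ADG: every operation belongs to a step that the run
  executes, and each step consists of at most c times its size many operations, where c is the
  implementation constant. Every executed loop test is at least one operation, so a run that
  does not terminate has infinite work.\<close>

definition adg_execution :: "nat \<Rightarrow> 'b comp_dag \<Rightarrow> ('b \<Rightarrow> adg_step) \<Rightarrow> bool" where
  "adg_execution c K stp \<longleftrightarrow>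
     is_dag K \<and>
     (\<forall>x\<in>ops K. executed (stp x)) \<and>
     (\<forall>i. executed (Guard i) \<longrightarrow> (\<exists>x\<in>ops K. stp x = Guard i)) \<and>
     (\<forall>p. finite {x\<in>ops K. stp x = p} \<and>
          card {x\<in>ops K. stp x = p} \<le> c * step_size p)"

end

end

theory Submission
  imports Defs
begin

text \<open>As long as D holds the degrees in the graph induced by U, Markov's inequality gives
  (1 + \<epsilon>) |U - R| \<le> |U|, so |U| is at most (1 + 1/\<epsilon>) |R|. The work of an iteration can
  therefore be charged to the vertices of R: a constant plus its degree for each of them. The sets
  R of the iterations are nonempty and disjoint, so there are at most n iterations, and the
  charges add up to O(n) plus the sum of all degrees.\<close>

text \<open>Double counting of incident pairs: \<open>u \<mapsto> {u, v}\<close> injects the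
  neighbours of \<open>v\<close> into the edges through \<open>v\<close>, and each edge contains two
  vertices.\<close>

lemma sum_deg_le:
  assumes "simple_graph V E"
  shows "(\<Sum>v\<in>V. deg V E v) \<le> 2 * card E"
proof -
  have fV: "finite V" and e: "\<And>e. e \<in> E \<Longrightarrow> e \<subseteq> V \<and> card e = 2"
    using assms by (auto simp: simple_graph_def)
  have "E \<subseteq> Pow V" using e by auto
  then have fE: "finite E" using fV by (meson finite_Pow_iff finite_subset)
  have "deg V E v \<le> card {e\<in>E. v \<in> e}" for v
    unfolding deg_def nbrs_def
  proof (rule card_inj_on_le[where f = "\<lambda>u. {u, v}"])
    show "inj_on (\<lambda>u. {u, v}) {u \<in> V. {u, v} \<in> E}"
      by (auto simp: inj_on_def doubleton_eq_iff)
  qed (use fE in auto)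
  then have "(\<Sum>v\<in>V. deg V E v) \<le> (\<Sum>v\<in>V. card {e\<in>E. v \<in> e})"
    by (intro sum_mono)
  also have "\<dots> = (\<Sum>v\<in>V. \<Sum>e\<in>E. if v \<in> e then 1 else 0)"
    using fE by (simp add: sum.If_cases Int_def)
  also have "\<dots> = (\<Sum>e\<in>E. \<Sum>v\<in>V. if v \<in> e then 1 else 0)"
    by (rule sum.swap)
  also have "\<dots> = (\<Sum>e\<in>E. card (V \<inter> e))"
    using fV by (simp add: sum.If_cases Int_def)
  also have "\<dots> = (\<Sum>e\<in>E. 2)"
    using e by (intro sum.cong refl) (metis Int_absorb1)
  finally show ?thesis by simp
qed

lemma adg_U_at_Suc: "adg_U_at V E \<epsilon> (Suc i) = adg_U_at V E \<epsilon> i - adg_R_at V E \<epsilon> i"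
  by (simp add: adg_state_at_def adg_body_def Let_def)

lemma adg_R_at_subset: "adg_R_at V E \<epsilon> i \<subseteq> adg_U_at V E \<epsilon> i"
  by (auto simp: adg_R_def)

lemma adg_U_at_subset: "adg_U_at V E \<epsilon> i \<subseteq> V"
proof (induction i)
  case 0
  then show ?case by (simp add: adg_state_at_def adg_init_def)
next
  case (Suc i)
  then show ?case by (auto simp: adg_U_at_Suc)
qed

text \<open>The loop invariant behind the Markov argument. It is restricted to \<open>v\<close> in
  the current U because the entry of a removed vertex is frozen while U keeps shrinking.\<close>

lemma adg_D_at:
  assumes "finite V" "v \<in> adg_U_at V E \<epsilon> i"
  shows "st_D (adg_state_at V E \<epsilon> i) v = int (card (nbrs E (adg_U_at V E \<epsilon> i) v))"
  using assms(2)
proof (induction i)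
  case 0
  then show ?case by (simp add: adg_state_at_def adg_init_def deg_def)
next
  case (Suc i)
  let ?s = "adg_state_at V E \<epsilon> i"
  let ?U = "st_U ?s" and ?R = "adg_R \<epsilon> ?s"
  have v: "v \<in> ?U" using Suc.prems by (simp add: adg_U_at_Suc)
  have fU: "finite ?U" using assms(1) adg_U_at_subset finite_subset by metis
  \<comment> \<open>Adjacency is symmetric, so the vertices of R that decrement \<open>v\<close> are
    exactly the neighbours of \<open>v\<close> in R.\<close>
  have R: "{w\<in>?R. v \<in> nbrs E ?U w} = nbrs E ?R v"
    using v by (auto simp: nbrs_def insert_commute)
  have sub: "nbrs E ?R v \<subseteq> nbrs E ?U v" and diff: "nbrs E (?U - ?R) v = nbrs E ?U v - nbrs E ?R v"
    using adg_R_at_subset by (fastforce simp: nbrs_def)+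
  have fin: "finite (nbrs E ?U v)" using fU by (simp add: nbrs_def)
  have "st_D (adg_state_at V E \<epsilon> (Suc i)) v = int (card (nbrs E ?U v)) - int (card (nbrs E ?R v))"
    using Suc.IH[OF v] R by (simp add: adg_state_at_def adg_body_def Let_def)
  also have "\<dots> = int (card (nbrs E (?U - ?R) v))"
    using sub fin by (simp add: diff card_Diff_subset finite_subset card_mono of_nat_diff)
  finally show ?case by (simp add: adg_U_at_Suc)
qed

text \<open>Every vertex of U - R has an entry above \<open>(1 + \<epsilon>) * adg_avg s\<close>,
  while the entries over U sum to |U| times the average. Nonnegative entries let the sum over U - R
  be bounded by the sum over U.\<close>

lemma card_U_le_card_R:
  assumes fin: "finite (st_U s)" and eps: "\<epsilon> > 0" and nonneg: "\<And>u. u \<in> st_U s \<Longrightarrow> st_D s u \<ge> 0"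
  shows "\<epsilon> * real (card (st_U s)) \<le> (1 + \<epsilon>) * real (card (adg_R \<epsilon> s))"
proof -
  let ?U = "st_U s" and ?R = "adg_R \<epsilon> s" and ?D = "\<lambda>u. real_of_int (st_D s u)"
  have RU: "?R \<subseteq> ?U" by (auto simp: adg_R_def)
  \<comment> \<open>For empty U both sides are 0, so division by zero does no harm.\<close>
  have total: "adg_avg s * card ?U = (\<Sum>v\<in>?U. ?D v)"
    using fin by (cases "?U = {}") (auto simp: adg_avg_def)
  have avg: "adg_avg s \<ge> 0"
    unfolding adg_avg_def using nonneg by (intro mult_nonneg_nonneg sum_nonneg) auto
  have "(1 + \<epsilon>) * card (?U - ?R) \<le> card ?U"
  \<comment> \<open>The average can be cancelled only if it is positive. If it is 0, all entries on
    U vanish and meet the threshold 0, so R is all of U.\<close>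
  proof (cases "adg_avg s = 0")
    case True
    then have "(\<Sum>v\<in>?U. ?D v) = 0" using total by simp
    then have "\<forall>v\<in>?U. ?D v = 0" using fin nonneg by (subst (asm) sum_nonneg_eq_0_iff) auto
    then have "?U - ?R = {}" using True by (auto simp: adg_R_def)
    then show ?thesis by (metis card.empty mult_zero_right of_nat_0 of_nat_0_le_iff)
  next
    case False
    then have pos: "adg_avg s > 0" using avg by simp
    have "((1 + \<epsilon>) * card (?U - ?R)) * adg_avg s = (\<Sum>v\<in>?U - ?R. (1 + \<epsilon>) * adg_avg s)"
      by simp
    also have "\<dots> \<le> (\<Sum>v\<in>?U - ?R. ?D v)"
      by (intro sum_mono) (auto simp: adg_R_def)
    also have "\<dots> \<le> (\<Sum>v\<in>?U. ?D v)"
      using fin nonneg by (intro sum_mono2) auto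
    also have "\<dots> = card ?U * adg_avg s" using total by (simp add: mult.commute)
    finally show ?thesis using pos by simp
  qed
  moreover have "real (card (?U - ?R)) = real (card ?U) - real (card ?R)"
    using RU fin by (simp add: card_Diff_subset finite_subset card_mono of_nat_diff)
  ultimately show ?thesis by (simp add: algebra_simps)
qed

text \<open>Rounding up gives a natural factor that depends on \<open>\<epsilon>\<close> alone. The
  invariant \<open>adg_D_at\<close> supplies the nonnegativity of the entries.\<close>

lemma card_U_at_le:
  assumes "finite V" "\<epsilon> > 0"
  shows "card (adg_U_at V E \<epsilon> i) \<le> nat \<lceil>(1 + \<epsilon>) / \<epsilon>\<rceil> * card (adg_R_at V E \<epsilon> i)"
proof -
  let ?U = "adg_U_at V E \<epsilon> i" and ?R = "adg_R_at V E \<epsilon> i"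
  have "finite ?U" using assms(1) adg_U_at_subset finite_subset by metis
  then have "\<epsilon> * real (card ?U) \<le> (1 + \<epsilon>) * real (card ?R)"
    using assms by (intro card_U_le_card_R) (auto simp: adg_D_at)
  then have "real (card ?U) \<le> (1 + \<epsilon>) / \<epsilon> * real (card ?R)"
    using assms(2) by (simp add: field_simps)
  also have "\<dots> \<le> real (nat \<lceil>(1 + \<epsilon>) / \<epsilon>\<rceil>) * real (card ?R)"
    by (intro mult_right_mono real_nat_ceiling_ge) simp
  finally show ?thesis by (simp flip: of_nat_mult)
qed

lemma sum_R_at_le:
  fixes f :: "'v \<Rightarrow> nat"
  assumes "finite V"
  shows "(\<Sum>i<k. \<Sum>v\<in>adg_R_at V E \<epsilon> i. f v) \<le> (\<Sum>v\<in>V. f v)"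
proof -
  \<comment> \<open>Keeping the weight of the remaining U turns the bound into an equality that
    telescopes.\<close>
  have "(\<Sum>i<k. \<Sum>v\<in>adg_R_at V E \<epsilon> i. f v) + (\<Sum>v\<in>adg_U_at V E \<epsilon> k. f v) = (\<Sum>v\<in>V. f v)"
  proof (induction k)
    case 0
    then show ?case by (simp add: adg_state_at_def adg_init_def)
  next
    case (Suc k)
    have "finite (adg_U_at V E \<epsilon> k)" using assms adg_U_at_subset finite_subset by metis
    then have "(\<Sum>v\<in>adg_U_at V E \<epsilon> k. f v)
        = (\<Sum>v\<in>adg_U_at V E \<epsilon> (Suc k). f v) + (\<Sum>v\<in>adg_R_at V E \<epsilon> k. f v)"
      unfolding adg_U_at_Suc by (rule sum.subset_diff[OF adg_R_at_subset])
    then show ?case using Suc.IH by simp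
  qed
  then show ?thesis by linarith
qed

text \<open>By \<open>card_U_at_le\<close> a nonempty U forces a nonempty R, and the sets R are
  disjoint subsets of \<open>V\<close>.\<close>

lemma iterations_le:
  assumes "finite V" "\<epsilon> > 0" "\<forall>j<i. adg_U_at V E \<epsilon> j \<noteq> {}"
  shows "i \<le> card V"
proof -
  have "1 \<le> card (adg_R_at V E \<epsilon> j)" if "j < i" for j
  proof (rule ccontr)
    assume "\<not> ?thesis"
    then have "card (adg_R_at V E \<epsilon> j) = 0" by simp
    then have "card (adg_U_at V E \<epsilon> j) = 0"
      using card_U_at_le[OF assms(1,2), of E j] by simp
    moreover have "finite (adg_U_at V E \<epsilon> j)" using assms(1) adg_U_at_subset finite_subset by metis
    ultimately show False using assms(3) that by simp
  qed
  then have "(\<Sum>j<i. 1) \<le> (\<Sum>j<i. card (adg_R_at V E \<epsilon> j))"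
    by (intro sum_mono) auto
  also have "\<dots> \<le> card V" using sum_R_at_le[OF assms(1), where f = "\<lambda>_. 1"] by simp
  finally show ?thesis by simp
qed

definition loop_steps :: "nat \<Rightarrow> adg_step set" where
  "loop_steps i = {Reduce i, Select i, Update i, Remove i, Assign i, Advance i}"

text \<open>The test that ends the loop is executed too, so the guards run up to
  \<open>card V\<close> inclusive and the loop bodies only below it.\<close>

lemma executed_subset:
  assumes "finite V" "\<epsilon> > 0" "executed V E \<epsilon> p"
  shows "p \<in> insert Init (Guard ` {..card V}) \<union> (\<Union>i<card V. loop_steps i)"
proof -
  have "i \<le> card V" if "\<forall>j<i. adg_U_at V E \<epsilon> j \<noteq> {}" for i
    using iterations_le[OF assms(1,2) that] .
  \<comment> \<open>\<open>iterates i\<close> includes test \<open>i\<close> itself, hence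
    \<open>Suc i\<close> successful tests.\<close>
  moreover have "i < card V" if "iterates V E \<epsilon> i" for i
    using iterations_le[OF assms(1,2), of "Suc i" E] that by (auto simp: iterates_def)
  ultimately show ?thesis
    using assms(3) by (cases p) (auto simp: loop_steps_def)
qed

text \<open>The sum may run over steps that are never executed, since the bounds on U and R hold for
  every index.\<close>

lemma sum_step_size_le:
  assumes "simple_graph V E" "\<epsilon> > 0"
  defines "n \<equiv> card V" and "M \<equiv> nat \<lceil>(1 + \<epsilon>) / \<epsilon>\<rceil>"
  shows "(\<Sum>p\<in>insert Init (Guard ` {..n}) \<union> (\<Union>i<n. loop_steps i). step_size V E \<epsilon> p)
    \<le> 2 + (2 * M + 5) * n + 2 * card E"
proof -
  let ?f = "step_size V E \<epsilon>" and ?R = "adg_R_at V E \<epsilon>"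
  have fV: "finite V" using assms(1) by (simp add: simple_graph_def)
  have cardR: "(\<Sum>i<n. card (?R i)) \<le> n"
    using sum_R_at_le[OF fV, where f = "\<lambda>_. 1"] by (simp add: n_def)
  have degR: "(\<Sum>i<n. \<Sum>v\<in>?R i. deg V E v) \<le> 2 * card E"
    using sum_R_at_le[OF fV] sum_deg_le[OF assms(1)] by (rule order_trans)
  have "(\<Sum>p\<in>(\<Union>i<n. loop_steps i). ?f p) = (\<Sum>i<n. \<Sum>p\<in>loop_steps i. ?f p)"
    by (intro sum.UNION_disjoint) (auto simp: loop_steps_def)
  \<comment> \<open>\<open>Reduce\<close> and \<open>Select\<close> cost at most
    \<open>M * card (?R i)\<close> each, \<open>Remove\<close> and \<open>Assign\<close>
    \<open>card (?R i)\<close> each; \<open>Advance\<close> gives the final 1.\<close>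
  also have "\<dots> \<le> (\<Sum>i<n. (2 * M + 2) * card (?R i) + (\<Sum>v\<in>?R i. deg V E v) + 1)"
  proof (intro sum_mono)
    fix i
    show "(\<Sum>p\<in>loop_steps i. ?f p) \<le> (2 * M + 2) * card (?R i) + (\<Sum>v\<in>?R i. deg V E v) + 1"
      using card_U_at_le[OF fV assms(2), of E i] by (simp add: loop_steps_def M_def algebra_simps)
  qed
  also have "\<dots> = (2 * M + 2) * (\<Sum>i<n. card (?R i)) + (\<Sum>i<n. \<Sum>v\<in>?R i. deg V E v) + n"
    unfolding sum.distrib sum_distrib_left by simp
  also have "\<dots> \<le> (2 * M + 2) * n + 2 * card E + n"
    using degR cardR by (intro add_mono mult_left_mono) simp_all
  finally have loop: "(\<Sum>p\<in>(\<Union>i<n. loop_steps i). ?f p) \<le> (2 * M + 3) * n + 2 * card E"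
    by (simp add: algebra_simps)
  have "(\<Sum>p\<in>Guard ` {..n}. ?f p) = n + 1"
    by (subst sum.reindex) (auto simp: inj_on_def)
  \<comment> \<open>\<open>Init\<close> contributes \<open>n + 1\<close>, as do the guards
    together.\<close>
  then have init: "(\<Sum>p\<in>insert Init (Guard ` {..n}). ?f p) = 2 * n + 2"
    by (subst sum.insert) (auto simp: n_def)
  have "(\<Sum>p\<in>insert Init (Guard ` {..n}) \<union> (\<Union>i<n. loop_steps i). ?f p)
      = (\<Sum>p\<in>insert Init (Guard ` {..n}). ?f p) + (\<Sum>p\<in>(\<Union>i<n. loop_steps i). ?f p)"
    by (intro sum.union_disjoint) (auto simp: loop_steps_def)
  then show ?thesis using init loop by (simp add: algebra_simps)
qed

text \<open>The operations split into the fibres of \<open>stp\<close>. A finite \<open>P\<close>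
  covering all executed steps makes their number finite, so the work is not \<infinity>.\<close>

lemma work_le:
  assumes "adg_execution V E \<epsilon> c K stp" and "finite P" and "\<And>p. executed V E \<epsilon> p \<Longrightarrow> p \<in> P"
  shows "work K \<le> enat (c * (\<Sum>p\<in>P. step_size V E \<epsilon> p))"
proof -
  let ?F = "\<lambda>p. {x\<in>ops K. stp x = p}"
  have F: "finite (?F p)" "card (?F p) \<le> c * step_size V E \<epsilon> p" for p
    using assms(1) by (auto simp: adg_execution_def)
  have ops: "ops K = (\<Union>p\<in>P. ?F p)"
    using assms(1,3) by (auto simp: adg_execution_def)
  have "finite (ops K)"
    by (subst ops) (use assms(2) F(1) in blast)
  moreover have "card (ops K) \<le> c * (\<Sum>p\<in>P. step_size V E \<epsilon> p)"
  proof -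
    have "card (ops K) \<le> (\<Sum>p\<in>P. card (?F p))"
      by (subst ops) (rule card_UN_le[OF assms(2)])
    also have "\<dots> \<le> (\<Sum>p\<in>P. c * step_size V E \<epsilon> p)" by (intro sum_mono F(2))
    finally show ?thesis by (simp add: sum_distrib_left)
  qed
  ultimately show ?thesis by (simp add: work_def)
qed

theorem lemma2:
  fixes \<epsilon> :: real and c :: nat
  assumes "\<epsilon> > 0"
  shows "\<exists>C::nat. \<forall>(V::'v set) (E::'v set set) (K::'b comp_dag) (stp::'b \<Rightarrow> adg_step).
           simple_graph V E \<longrightarrow> adg_execution V E \<epsilon> c K stp \<longrightarrow>
           work K \<le> enat (C * max 1 (card V + card E))"
proof -
  define M where "M = nat \<lceil>(1 + \<epsilon>) / \<epsilon>\<rceil>"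
  \<comment> \<open>\<open>2 * M + 7\<close> is \<open>2 * M + 5\<close> plus the additive 2 of
    \<open>sum_step_size_le\<close>, which the \<open>max 1\<close> absorbs even for the empty
    graph.\<close>
  have "work K \<le> enat (c * (2 * M + 7) * max 1 (card V + card E))"
    if G: "simple_graph V E" and K: "adg_execution V E \<epsilon> c K stp"
    for V :: "'v set" and E and K :: "'b comp_dag" and stp
  proof -
    let ?P = "insert Init (Guard ` {..card V}) \<union> (\<Union>i<card V. loop_steps i)"
    let ?N = "max 1 (card V + card E)"
    have "finite V" using G by (simp add: simple_graph_def)
    then have "work K \<le> enat (c * (\<Sum>p\<in>?P. step_size V E \<epsilon> p))"
      using executed_subset[OF _ assms]
      by (intro work_le[OF K]) (simp add: loop_steps_def, blast)
    moreover
    have "(\<Sum>p\<in>?P. step_size V E \<epsilon> p) \<le> (2 * M + 7) * ?N"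
    proof -
      have "(\<Sum>p\<in>?P. step_size V E \<epsilon> p) \<le> 2 + (2 * M + 5) * card V + 2 * card E"
        using sum_step_size_le[OF G assms] by (simp add: M_def)
      also have "\<dots> \<le> 2 * ?N + (2 * M + 5) * card V + (2 * M + 5) * card E"
        by (intro add_mono mult_le_mono) auto
      also have "\<dots> \<le> 2 * ?N + (2 * M + 5) * ?N"
        by (simp add: add.assoc flip: distrib_left)
      finally show ?thesis by (simp add: algebra_simps)
    qed
    then have "enat (c * (\<Sum>p\<in>?P. step_size V E \<epsilon> p)) \<le> enat (c * (2 * M + 7) * ?N)"
      unfolding enat_ord_simps mult.assoc[of c] by (rule mult_le_mono2)
    ultimately show ?thesis by (rule order_trans)
  qed
  then show ?thesis by blast
qed

end
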